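(* Let $Q\subset\mathbb{R}^d$ be compact and connected with non-empty interior, and let $\ell\in\mathbb{N}$. The pair $(\mathcal{C}_{(\ell)}^*,d_\ominus)$ is a metric space and, with the topology induced by $d_\ominus$, the set $\mathcal{C}_{(\ell)}^*$ is compact.
   Context: $\mu$ is Lebesgue measure on $\mathbb{R}^d$. $\mathcal{C}$ is the set of closed subsets of $Q$. For $A,B\in\mathcal{C}$, $A\ominus B=(A\cup B)\setminus(A\cap B)$ and $d_\ominus(A,B)=\mu(A\ominus B)$. Write $A\sim B$ if $\mu(A\ominus B)=0$; this is an equivalence relation on $\mathcal{C}$, and $d_\ominus$ is defined on equivalence classes through representatives. $\mathcal{C}_{(\ell)}\subset\mathcal{C}$ is the set of subsets of $Q$ of the form $S_1\cup\dots\cup S_\ell$ with $S_1,\dots,S_\ell\subseteq Q$ convex and closed (not necessarily distinct). $\mathcal{C}_{(\ell)}^*=\mathcal{C}_{(\ell)}/\!\sim$ is the corresponding set of equivalence classes. *)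

theory Defs
  imports "HOL-Analysis.Analysis"
begin

definition sym_difference :: "'a set \<Rightarrow> 'a set \<Rightarrow> 'a set"  (infixl "\<ominus>" 65)
  where "A \<ominus> B = (A \<union> B) - (A \<inter> B)"

definition closed_subsets :: "(real ^ 'd) set \<Rightarrow> (real ^ 'd) set set"
  where "closed_subsets Q = {A. closed A \<and> A \<subseteq> Q}"

definition d_sym :: "(real ^ 'd) set \<Rightarrow> (real ^ 'd) set \<Rightarrow> real"
  where "d_sym A B = measure lebesgue (A \<ominus> B)"

definition ae_eq :: "(real ^ 'd) set \<Rightarrow> ((real ^ 'd) set \<times> (real ^ 'd) set) set"
  where "ae_eq Q = {(A, B). A \<in> closed_subsets Q \<and> B \<in> closed_subsets Q \<and>
                             emeasure lebesgue (A \<ominus> B) = 0}"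

text \<open>The pieces may coincide or be empty; for \<open>l = 0\<close> the union is empty.\<close>
definition convex_unions :: "(real ^ 'd) set \<Rightarrow> nat \<Rightarrow> (real ^ 'd) set set"
  where "convex_unions Q l =
    {A. \<exists>S :: nat \<Rightarrow> (real ^ 'd) set.
          (\<forall>i\<in>{1..l}. convex (S i) \<and> closed (S i) \<and> S i \<subseteq> Q) \<and> A = (\<Union>i\<in>{1..l}. S i)}"

definition convex_union_classes :: "(real ^ 'd) set \<Rightarrow> nat \<Rightarrow> (real ^ 'd) set set set"
  where "convex_union_classes Q l = convex_unions Q l // Restr (ae_eq Q) (convex_unions Q l)"

text \<open>The choice of representatives is irrelevant, see \<open>d_class_eq\<close> below.\<close>
definition d_class :: "(real ^ 'd) set set \<Rightarrow> (real ^ 'd) set set \<Rightarrow> real"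
  where "d_class X Y = d_sym (SOME A. A \<in> X) (SOME B. B \<in> Y)"

lemma convex_unions_subset: "convex_unions Q l \<subseteq> closed_subsets Q"
  by (auto simp: convex_unions_def closed_subsets_def intro!: closed_UN)

lemma closed_subsets_fmeasurable:
  assumes "compact Q" "A \<in> closed_subsets Q"
  shows "A \<in> lmeasurable"
proof -
  have "compact A"
    using assms compact_Int_closed[of Q A] by (auto simp: closed_subsets_def Int_absorb1)
  then show ?thesis by (rule lmeasurable_compact)
qed

lemma sym_difference_lmeasurable:
  "A \<in> lmeasurable \<Longrightarrow> B \<in> lmeasurable \<Longrightarrow> A \<ominus> B \<in> lmeasurable"
  unfolding sym_difference_def by (intro fmeasurable.Diff fmeasurable.Un fmeasurable.Int)

lemma sym_difference_commute: "A \<ominus> B = B \<ominus> A"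
  by (auto simp: sym_difference_def)

lemma equiv_ae_eq: "equiv (closed_subsets Q) (ae_eq Q)"
proof (intro equivI)
  show "refl_on (closed_subsets Q) (ae_eq Q)"
    by (auto simp: refl_on_def ae_eq_def sym_difference_def)
  show "sym (ae_eq Q)"
    by (auto simp: sym_def ae_eq_def sym_difference_commute)
  show "trans (ae_eq Q)"
  proof (rule transI)
    fix A B C assume AB: "(A, B) \<in> ae_eq Q" and BC: "(B, C) \<in> ae_eq Q"
    have meas: "X \<ominus> Y \<in> sets lebesgue"
      if "X \<in> closed_subsets Q" "Y \<in> closed_subsets Q" for X Y
      using that by (auto simp: closed_subsets_def sym_difference_def)
    have "A \<ominus> C \<subseteq> (A \<ominus> B) \<union> (B \<ominus> C)" by (auto simp: sym_difference_def)
    moreover have "(A \<ominus> B) \<union> (B \<ominus> C) \<in> null_sets lebesgue"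
      using AB BC meas by (intro null_sets.Un) (auto simp: ae_eq_def null_sets_def)
    ultimately have "A \<ominus> C \<in> null_sets lebesgue"
      using AB BC meas by (auto simp: ae_eq_def intro: null_sets_subset)
    then show "(A, C) \<in> ae_eq Q" using AB BC by (auto simp: ae_eq_def)
  qed
qed (auto simp: ae_eq_def)

lemma d_sym_commute: "d_sym A B = d_sym B A"
  by (simp add: d_sym_def sym_difference_commute)

lemma d_sym_triangle:
  assumes "A \<in> lmeasurable" "B \<in> lmeasurable" "C \<in> lmeasurable"
  shows "d_sym A C \<le> d_sym A B + d_sym B C"
proof -
  note m = sym_difference_lmeasurable
  have "measure lebesgue (A \<ominus> C) \<le> measure lebesgue ((A \<ominus> B) \<union> (B \<ominus> C))"
    using assms by (intro measure_mono_fmeasurable)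
      (auto simp: sym_difference_def intro!: fmeasurableD m[unfolded sym_difference_def])
  also have "\<dots> \<le> measure lebesgue (A \<ominus> B) + measure lebesgue (B \<ominus> C)"
    using assms by (intro measure_Un_le fmeasurableD m)
  finally show ?thesis by (simp add: d_sym_def)
qed

lemma d_sym_cong:
  assumes Q: "compact Q" and AA: "(A, A') \<in> ae_eq Q" and BB: "(B, B') \<in> ae_eq Q"
  shows "d_sym A B = d_sym A' B'"
proof -
  have z: "d_sym A A' = 0" "d_sym B B' = 0"
    using AA BB by (auto simp: d_sym_def ae_eq_def measure_def)
  have m: "A \<in> lmeasurable" "A' \<in> lmeasurable" "B \<in> lmeasurable" "B' \<in> lmeasurable"
    using AA BB closed_subsets_fmeasurable[OF Q] by (auto simp: ae_eq_def)
  have "d_sym A B \<le> d_sym A' B'"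
    using d_sym_triangle[OF m(1,2,3)] d_sym_triangle[OF m(2,4,3)] z d_sym_commute[of B' B] by simp
  moreover have "d_sym A' B' \<le> d_sym A B"
    using d_sym_triangle[OF m(2,1,4)] d_sym_triangle[OF m(1,3,4)] z d_sym_commute[of A' A] by simp
  ultimately show ?thesis by simp
qed

lemma convex_union_classes_related:
  assumes "X \<in> convex_union_classes Q l" "A \<in> X" "A' \<in> X"
  shows "(A, A') \<in> ae_eq Q"
proof -
  have "equiv (convex_unions Q l) (Restr (ae_eq Q) (convex_unions Q l))"
    using equiv_ae_eq[of Q] convex_unions_subset[of Q l]
    by (auto simp: equiv_def refl_on_def sym_def intro: trans_Restr)
  from quotient_eq_iff[OF this assms(1)[unfolded convex_union_classes_def]
      assms(1)[unfolded convex_union_classes_def] assms(2,3)]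
  show ?thesis by simp
qed

lemma d_class_eq:
  assumes "compact Q" and "X \<in> convex_union_classes Q l" and "Y \<in> convex_union_classes Q l"
    and "A \<in> X" and "B \<in> Y"
  shows "d_class X Y = d_sym A B"
  unfolding d_class_def
  using assms by (intro d_sym_cong[of Q] convex_union_classes_related[of _ Q l]) (auto intro: someI)

end

theory Submission
  imports Defs "HOL-Complex_Analysis.Great_Picard"
begin

text \<open>
  Compactness reduces to a selection principle for a single sequence of convex closed subsets of
  \<open>Q\<close>, applied successively to the \<open>l\<close> pieces. By Arzela--Ascoli the distance functions of the sets
  converge uniformly along a subsequence, and the limit set \<open>K\<close> is the zero set of the limit
  function. A point outside \<open>K\<close> eventually leaves the sets, and a point in the interior of \<open>K\<close>
  eventually enters them by convexity. Since the frontier of the convex set \<open>K\<close> is negligible,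
  the indicator functions converge almost everywhere, and dominated convergence concludes.
\<close>

section \<open>Distance functions of closed convex sets\<close>

text \<open>The same convex combination of nearest points to \<open>x\<close> and \<open>y\<close>
  lies in \<open>C\<close>. In the limit, this inequality makes the zero set of the limit function
  convex.\<close>

lemma convex_infdist_le:
  fixes C :: "'a::euclidean_space set"
  assumes "convex C" "closed C" "C \<noteq> {}" "0 \<le> u" "0 \<le> v" "u + v = 1"
  shows "infdist (u *\<^sub>R x + v *\<^sub>R y) C \<le> u * infdist x C + v * infdist y C"
proof -
  obtain p where p: "p \<in> C" "infdist x C = dist x p"
    using infdist_attains_inf assms by blast
  obtain q where q: "q \<in> C" "infdist y C = dist y q"
    using infdist_attains_inf assms by blast
  have "u *\<^sub>R p + v *\<^sub>R q \<in> C"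
    using assms p(1) q(1) by (simp add: convexD)
  then have "infdist (u *\<^sub>R x + v *\<^sub>R y) C \<le> dist (u *\<^sub>R x + v *\<^sub>R y) (u *\<^sub>R p + v *\<^sub>R q)"
    by (rule infdist_le)
  also have "\<dots> = norm (u *\<^sub>R (x - p) + v *\<^sub>R (y - q))"
    by (simp add: dist_norm algebra_simps)
  also have "\<dots> \<le> u * dist x p + v * dist y q"
    using norm_triangle_ineq[of "u *\<^sub>R (x - p)" "v *\<^sub>R (y - q)"] assms by (simp add: dist_norm)
  finally show ?thesis using p q by simp
qed

text \<open>Otherwise, moving from \<open>x\<close> by \<open>r\<close> away from a separating hyperplane reaches a point of the
  ball at distance at least \<open>r\<close> from \<open>C\<close>.\<close>
lemma mem_closed_convex_if_cball_near:
  fixes C :: "'a::euclidean_space set"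
  assumes C: "convex C" "closed C" "C \<noteq> {}" and "0 < r"
    and near: "\<And>y. y \<in> cball x r \<Longrightarrow> infdist y C < r"
  shows "x \<in> C"
proof (rule ccontr)
  assume "x \<notin> C"
  then obtain a b where ab: "a \<bullet> x < b" "\<And>z. z \<in> C \<Longrightarrow> b < a \<bullet> z"
    using separating_hyperplane_closed_point[OF C(1,2)] by blast
  then have a: "a \<noteq> 0" using C by force
  define y where "y = x - (r / norm a) *\<^sub>R a"
  have "y \<in> cball x r" using a \<open>0 < r\<close> by (simp add: y_def dist_norm)
  moreover obtain z where z: "z \<in> C" "infdist y C = dist y z"
    using infdist_attains_inf C by blast
  moreover have "r \<le> dist y z"
  proof -
    have "a \<bullet> (z - y) = a \<bullet> z - a \<bullet> x + r * norm a"
      using a by (simp add: y_def inner_diff_right power2_norm_eq_inner[symmetric] power2_eq_square)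
    then have "r * norm a \<le> a \<bullet> (z - y)"
      using ab(1) ab(2)[OF z(1)] by simp
    also have "\<dots> \<le> norm a * dist y z"
      by (metis dist_commute dist_norm norm_cauchy_schwarz)
    finally show ?thesis using a by (simp add: mult.commute)
  qed
  ultimately show False using near by force
qed

section \<open>Selection for one sequence of convex sets\<close>

text \<open>Dominated convergence for the indicators of the symmetric differences, with the
  indicator of \<open>B\<close> as majorant. Outside \<open>B\<close> these indicators vanish, so
  \<open>lim\<close> is only required inside.\<close>

lemma measure_sym_difference_tendsto_0:
  fixes C :: "nat \<Rightarrow> 'a::euclidean_space set"
  assumes B: "B \<in> lmeasurable" and C: "\<And>n. C n \<in> sets lebesgue" "\<And>n. C n \<subseteq> B"
    and K: "K \<in> sets lebesgue" "K \<subseteq> B"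
    and N: "negligible N"
    and lim: "\<And>x. x \<in> B - N \<Longrightarrow> eventually (\<lambda>n. x \<in> C n \<longleftrightarrow> x \<in> K) sequentially"
  shows "(\<lambda>n. measure lebesgue (C n \<ominus> K)) \<longlonglongrightarrow> 0"
proof -
  have m: "C n \<ominus> K \<in> sets lebesgue" for n
    using C K by (auto simp: sym_difference_def)
  have "(\<lambda>n. integral\<^sup>L lebesgue (indicator (C n \<ominus> K) :: 'a \<Rightarrow> real))
      \<longlonglongrightarrow> integral\<^sup>L (lebesgue :: 'a measure) (\<lambda>_. 0)"
  proof (rule integral_dominated_convergence[where w = "indicator B"])
    show "integrable lebesgue (indicator B :: 'a \<Rightarrow> real)"
      using B by (simp add: lmeasurable_iff_integrable)
    show "AE x in lebesgue. (\<lambda>n. indicator (C n \<ominus> K) x) \<longlonglongrightarrow> (0::real)"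
    proof (rule AE_I')
      show "N \<in> null_sets lebesgue" using N by (simp add: negligible_iff_null_sets)
      have "(\<lambda>n. indicator (C n \<ominus> K) x) \<longlonglongrightarrow> (0::real)" if "x \<notin> N" for x
      proof (cases "x \<in> B")
        case True
        with lim[of x] that have "eventually (\<lambda>n. indicator (C n \<ominus> K) x = (0::real)) sequentially"
          by (auto elim!: eventually_mono simp: sym_difference_def)
        then show ?thesis by (rule tendsto_eventually)
      next
        case False
        then have "x \<notin> C n \<ominus> K" for n using C K by (auto simp: sym_difference_def)
        then show ?thesis by simp
      qed
      then show "{x \<in> space lebesgue. \<not> (\<lambda>n. indicator (C n \<ominus> K) x) \<longlonglongrightarrow> (0::real)} \<subseteq> N"
        by blast
    qed
    show "AE x in lebesgue. norm (indicator (C n \<ominus> K) x :: real) \<le> indicator B x" for n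
      using C(2)[of n] K(2) by (intro AE_I2) (auto simp: sym_difference_def split: split_indicator)
  qed (use m in auto)
  then show ?thesis using m by simp
qed

text \<open>A form of Blaschke selection. Empty terms are excluded here because
  \<open>infdist\<close> to the empty set is 0 by convention, so the distance function would not
  detect them.\<close>

lemma convex_selection_nonempty:
  fixes C :: "nat \<Rightarrow> 'a::euclidean_space set"
  assumes Q: "compact Q"
    and C: "\<And>n. convex (C n)" "\<And>n. closed (C n)" "\<And>n. C n \<subseteq> Q" "\<And>n. C n \<noteq> {}"
  obtains K r where "convex K" "closed K" "K \<subseteq> Q" "strict_mono (r :: nat \<Rightarrow> nat)"
    "(\<lambda>n. measure lebesgue (C (r n) \<ominus> K)) \<longlonglongrightarrow> 0"
proof -
  \<comment> \<open>\<open>Q\<close> itself may fail to be convex. On its hull, a segment joining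
    two zeros of the limit function stays in the domain.\<close>
  define B where "B = convex hull Q"
  have B: "compact B" "convex B" "Q \<subseteq> B"
    using Q by (auto simp: B_def compact_convex_hull hull_subset)
  have lip: "\<bar>infdist x A - infdist y A\<bar> \<le> norm (x - y)" for x y and A :: "'a set"
    using infdist_triangle_abs[of x A y] by (simp add: dist_norm)
  have bound: "norm (infdist x (C n)) \<le> diameter B" if "x \<in> B" for x n
  proof -
    obtain z where "z \<in> C n" using C(4) by blast
    then show ?thesis
      using infdist_le[of z "C n" x] diameter_bounded_bound[of B x z] that B C(3)[of n]
      by (force simp: infdist_nonneg compact_imp_bounded)
  qed
  obtain g r where g: "continuous_on B g" and r: "strict_mono (r :: nat \<Rightarrow> nat)"
    and unif: "\<And>e. 0 < e \<Longrightarrow> \<exists>N. \<forall>n x. n \<ge> N \<and> x \<in> B \<longrightarrow> norm (infdist x (C (r n)) - g x) < e"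
  proof (rule Arzela_Ascoli[of B "\<lambda>n x. infdist x (C n)"])
    \<comment> \<open>Distance functions are 1-Lipschitz, so \<open>d = e\<close> gives
      equicontinuity for all \<open>n\<close> at once.\<close>
    show "\<exists>d. 0 < d \<and> (\<forall>n y. y \<in> B \<and> norm (x - y) < d \<longrightarrow>
        norm (infdist x (C n) - infdist y (C n)) < e)" if "0 < e" for x e
      using that lip by (intro exI[of _ e]) (auto intro: le_less_trans)
  qed (use B bound in auto)
  have lim: "(\<lambda>n. infdist x (C (r n))) \<longlonglongrightarrow> g x" if "x \<in> B" for x
    using unif that by (force simp: LIMSEQ_iff)
  have g0: "0 \<le> g x" if "x \<in> B" for x
    using LIMSEQ_le_const[OF lim[OF that]] infdist_nonneg by blast
  define K where "K = {x \<in> B. g x = 0}"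
  have "convex K"
    unfolding convex_def
  proof (intro ballI allI impI)
    fix x y u v assume *: "x \<in> K" "y \<in> K" "0 \<le> (u::real)" "0 \<le> v" "u + v = 1"
    define w where "w = u *\<^sub>R x + v *\<^sub>R y"
    have w: "w \<in> B" using * B(2) by (auto simp: w_def K_def convexD)
    have "(\<lambda>n. u * infdist x (C (r n)) + v * infdist y (C (r n))) \<longlonglongrightarrow> u * g x + v * g y"
      using * by (intro tendsto_intros lim) (auto simp: K_def)
    moreover have "infdist w (C (r n)) \<le> u * infdist x (C (r n)) + v * infdist y (C (r n))" for n
      unfolding w_def using C * by (intro convex_infdist_le)
    ultimately have "g w \<le> u * g x + v * g y"
      using lim[OF w] by (blast intro: LIMSEQ_le)
    then show "u *\<^sub>R x + v *\<^sub>R y \<in> K"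
      using * w g0[OF w] by (simp add: K_def w_def)
  qed
  moreover have "closed K"
    unfolding K_def using g B by (intro continuous_closed_preimage_constant compact_imp_closed)
  moreover have "K \<subseteq> Q"
  proof
    fix x assume x: "x \<in> K"
    then have "Q \<noteq> {}" using C(3,4) by blast
    \<comment> \<open>\<open>K\<close> was only placed in the hull. It lies in \<open>Q\<close>
      because the distance to the larger set \<open>Q\<close> is at most the distance to
      \<open>C (r n)\<close>, which tends to 0 on \<open>K\<close>.\<close>
    have "infdist x Q \<le> infdist x (C (r n))" for n
      using C(3,4) by (intro infdist_mono) auto
    then have "infdist x Q \<le> g x"
      using lim x by (intro LIMSEQ_le_const[OF lim]) (auto simp: K_def)
    then have "infdist x Q = 0" using x infdist_nonneg[of x Q] by (simp add: K_def)
    then show "x \<in> Q"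
      using in_closed_iff_infdist_zero compact_imp_closed[OF Q] \<open>Q \<noteq> {}\<close> by blast
  qed
  moreover have "(\<lambda>n. measure lebesgue (C (r n) \<ominus> K)) \<longlonglongrightarrow> 0"
  proof (rule measure_sym_difference_tendsto_0)
    show "negligible (frontier K)" using \<open>convex K\<close> by (rule negligible_convex_frontier)
    fix x assume x: "x \<in> Q - frontier K"
    show "eventually (\<lambda>n. x \<in> C (r n) \<longleftrightarrow> x \<in> K) sequentially"
    proof (cases "x \<in> K")
      case True
      then have "x \<in> interior K" using x \<open>closed K\<close> by (simp add: frontier_def)
      then obtain e where e: "0 < e" "cball x e \<subseteq> K" by (auto simp: mem_interior_cball)
      \<comment> \<open>The limit \<open>g\<close> vanishes on the whole ball, and uniform
        convergence provides one \<open>N\<close> for all its points.\<close>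
      obtain N where N: "\<And>n y. n \<ge> N \<Longrightarrow> y \<in> B \<Longrightarrow> norm (infdist y (C (r n)) - g y) < e"
        using unif[OF e(1)] by blast
      have "x \<in> C (r n)" if "n \<ge> N" for n
      proof (rule mem_closed_convex_if_cball_near)
        fix y assume "y \<in> cball x e"
        then have "y \<in> B" "g y = 0" using e by (auto simp: K_def)
        then show "infdist y (C (r n)) < e" using N[OF that] by fastforce
      qed (use C e in auto)
      then show ?thesis using True by (auto simp: eventually_sequentially)
    next
      case False
      \<comment> \<open>Here pointwise convergence suffices: a positive limit keeps the distances
        eventually positive, which excludes membership.\<close>
      have "x \<in> B" using x B by auto
      with False have "0 < g x" using g0[of x] by (force simp: K_def)
      then have "eventually (\<lambda>n. 0 < infdist x (C (r n))) sequentially"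
        using lim[OF \<open>x \<in> B\<close>] by (rule order_tendstoD(1)[rotated])
      then show ?thesis using False by (auto elim!: eventually_mono)
    qed
  qed (use Q C \<open>closed K\<close> \<open>K \<subseteq> Q\<close> in \<open>auto intro: lmeasurable_compact\<close>)
  ultimately show thesis using r that by blast
qed

text \<open>If infinitely many terms are empty, they form a subsequence with limit
  \<open>{}\<close>. Otherwise the nonempty terms form a subsequence to which the previous selection
  applies.\<close>

lemma convex_selection:
  fixes C :: "nat \<Rightarrow> 'a::euclidean_space set"
  assumes Q: "compact Q" and C: "\<And>n. convex (C n)" "\<And>n. closed (C n)" "\<And>n. C n \<subseteq> Q"
  obtains K r where "convex K" "closed K" "K \<subseteq> Q" "strict_mono (r :: nat \<Rightarrow> nat)"
    "(\<lambda>n. measure lebesgue (C (r n) \<ominus> K)) \<longlonglongrightarrow> 0"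
proof (cases "infinite {n. C n = {}}")
  case True
  then obtain r :: "nat \<Rightarrow> nat" where "strict_mono r" "\<And>n. C (r n) = {}"
    using infinite_enumerate[of "{n. C n = {}}"] by auto
  then show thesis using that[of "{}" r] by (simp add: sym_difference_def)
next
  case False
  then have "infinite {n. C n \<noteq> {}}"
    using finite_Collect_not[of "\<lambda>n. C n = {}"] by simp
  then obtain r :: "nat \<Rightarrow> nat" where r: "strict_mono r" "\<And>n. C (r n) \<noteq> {}"
    using infinite_enumerate[of "{n. C n \<noteq> {}}"] by auto
  obtain K s where "convex K" "closed K" "K \<subseteq> Q" "strict_mono (s :: nat \<Rightarrow> nat)"
    "(\<lambda>n. measure lebesgue (C (r (s n)) \<ominus> K)) \<longlonglongrightarrow> 0"
    by (rule convex_selection_nonempty[OF Q, of "\<lambda>n. C (r n)"]) (use C r in auto)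
  then show thesis using that[of K "r \<circ> s"] r(1) by (simp add: strict_mono_o)
qed

section \<open>Finite families and their unions\<close>

text \<open>Each new index costs one further thinning of the sequence, and the limits already found
  survive passage to a subsequence.\<close>

lemma convex_selection_finite:
  fixes S :: "nat \<Rightarrow> 'i \<Rightarrow> 'a::euclidean_space set"
  assumes "finite I" and Q: "compact Q"
    and S: "\<And>n i. i \<in> I \<Longrightarrow> convex (S n i) \<and> closed (S n i) \<and> S n i \<subseteq> Q"
  shows "\<exists>T r. strict_mono (r :: nat \<Rightarrow> nat) \<and>
    (\<forall>i\<in>I. convex (T i) \<and> closed (T i) \<and> T i \<subseteq> Q \<and>
       (\<lambda>n. measure lebesgue (S (r n) i \<ominus> T i)) \<longlonglongrightarrow> 0)"
  using assms(1) S
proof (induction I rule: finite_induct)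
  case empty
  show ?case by (auto intro: exI[of _ id] simp: strict_mono_id)
next
  case (insert j I)
  then obtain T r where r: "strict_mono (r :: nat \<Rightarrow> nat)"
    and T: "\<And>i. i \<in> I \<Longrightarrow> convex (T i) \<and> closed (T i) \<and> T i \<subseteq> Q \<and>
       (\<lambda>n. measure lebesgue (S (r n) i \<ominus> T i)) \<longlonglongrightarrow> 0"
    by (metis insertCI)
  obtain K s where K: "convex K" "closed K" "K \<subseteq> Q" and s: "strict_mono (s :: nat \<Rightarrow> nat)"
    and lim: "(\<lambda>n. measure lebesgue (S (r (s n)) j \<ominus> K)) \<longlonglongrightarrow> 0"
    by (rule convex_selection[OF Q, of "\<lambda>n. S (r n) j"]) (use insert.prems in auto)
  have "(\<lambda>n. measure lebesgue (S (r (s n)) i \<ominus> T i)) \<longlonglongrightarrow> 0" if "i \<in> I" for i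
    using LIMSEQ_subseq_LIMSEQ[OF _ s] T[OF that] by (fastforce simp: o_def)
  then show ?case
    using K lim T r s insert.hyps
    by (intro exI[of _ "T(j := K)"] exI[of _ "r \<circ> s"]) (auto simp: strict_monoD strict_monoI)
qed

text \<open>The symmetric difference of two unions is contained in the union of the symmetric
  differences. Convergence of the pieces thus carries over to their unions.\<close>

lemma measure_sym_difference_UN_le:
  assumes "finite I" "\<And>i. i \<in> I \<Longrightarrow> A i \<in> lmeasurable" "\<And>i. i \<in> I \<Longrightarrow> B i \<in> lmeasurable"
  shows "measure lebesgue ((\<Union>i\<in>I. A i) \<ominus> (\<Union>i\<in>I. B i)) \<le> (\<Sum>i\<in>I. measure lebesgue (A i \<ominus> B i))"
proof -
  have m: "A i \<ominus> B i \<in> lmeasurable" if "i \<in> I" for i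
    using assms that by (auto simp: sym_difference_def intro!: fmeasurable.Diff)
  have "(\<Union>i\<in>I. A i) \<in> lmeasurable" "(\<Union>i\<in>I. B i) \<in> lmeasurable"
    using assms by (auto intro!: fmeasurable.finite_UN)
  then have "(\<Union>i\<in>I. A i) \<ominus> (\<Union>i\<in>I. B i) \<in> sets lebesgue"
    by (auto simp: sym_difference_def)
  then have "measure lebesgue ((\<Union>i\<in>I. A i) \<ominus> (\<Union>i\<in>I. B i)) \<le> measure lebesgue (\<Union>i\<in>I. A i \<ominus> B i)"
    using assms(1) m
    by (intro measure_mono_fmeasurable fmeasurable.finite_UN) (auto simp: sym_difference_def)
  also have "\<dots> \<le> (\<Sum>i\<in>I. measure lebesgue (A i \<ominus> B i))"
    using assms(1) m by (intro measure_UNION_le) auto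
  finally show ?thesis .
qed

text \<open>This is sequential compactness at the level of representatives. All terms share the
  index set \<open>{1..l}\<close>, so a common subsequence can be chosen for all pieces.\<close>

lemma convex_unions_selection:
  fixes Q :: "(real ^ 'd) set"
  assumes Q: "compact Q" and A: "\<And>n. A n \<in> convex_unions Q l"
  obtains L r where "L \<in> convex_unions Q l" "strict_mono (r :: nat \<Rightarrow> nat)"
    "(\<lambda>n. d_sym (A (r n)) L) \<longlonglongrightarrow> 0"
proof -
  have "\<exists>S. (\<forall>i\<in>{1..l}. convex (S i) \<and> closed (S i) \<and> S i \<subseteq> Q) \<and> A n = (\<Union>i\<in>{1..l}. S i)" for n
    using A[of n] by (simp add: convex_unions_def)
  then obtain S where S: "\<And>n i. i \<in> {1..l} \<Longrightarrow> convex (S n i) \<and> closed (S n i) \<and> S n i \<subseteq> Q"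
    and AS: "\<And>n. A n = (\<Union>i\<in>{1..l}. S n i)"
    by metis
  obtain T r where r: "strict_mono (r :: nat \<Rightarrow> nat)"
    and T: "\<forall>i\<in>{1..l}. convex (T i) \<and> closed (T i) \<and> T i \<subseteq> Q \<and>
      (\<lambda>n. measure lebesgue (S (r n) i \<ominus> T i)) \<longlonglongrightarrow> 0"
    using convex_selection_finite[of "{1..l}" Q S, OF finite_atLeastAtMost Q S] by blast
  have meas: "X \<in> lmeasurable" if "closed X" "X \<subseteq> Q" for X
    using closed_subsets_fmeasurable[OF Q] that by (auto simp: closed_subsets_def)
  have "(\<lambda>n. d_sym (A (r n)) (\<Union>i\<in>{1..l}. T i)) \<longlonglongrightarrow> 0"
  proof (rule tendsto_sandwich[of "\<lambda>_. 0"])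
    show "(\<lambda>n. \<Sum>i\<in>{1..l}. measure lebesgue (S (r n) i \<ominus> T i)) \<longlonglongrightarrow> 0"
      using T by (intro tendsto_null_sum) blast
    show "\<forall>\<^sub>F n in sequentially. d_sym (A (r n)) (\<Union>i\<in>{1..l}. T i)
        \<le> (\<Sum>i\<in>{1..l}. measure lebesgue (S (r n) i \<ominus> T i))"
      unfolding d_sym_def AS using S T meas
      by (intro always_eventually allI measure_sym_difference_UN_le) auto
  qed (auto simp: d_sym_def)
  moreover have "(\<Union>i\<in>{1..l}. T i) \<in> convex_unions Q l"
    using T by (auto simp: convex_unions_def)
  ultimately show thesis using r that by blast
qed

section \<open>The metric on classes and its compactness\<close>

lemma equiv_convex_unions:
  "equiv (convex_unions Q l) (Restr (ae_eq Q) (convex_unions Q l))"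
  using equiv_ae_eq[of Q] convex_unions_subset[of Q l]
  by (auto simp: equiv_def refl_on_def sym_def intro: trans_Restr)

text \<open>Compactness of \<open>Q\<close> makes the measure finite, so \<open>measure\<close> and
  \<open>emeasure\<close> vanish together; for infinite measure, \<open>measure\<close> would be 0
  by default.\<close>

lemma ae_eq_iff_d_sym:
  assumes "compact Q" "A \<in> closed_subsets Q" "B \<in> closed_subsets Q"
  shows "(A, B) \<in> ae_eq Q \<longleftrightarrow> d_sym A B = 0"
proof -
  have "A \<ominus> B \<in> lmeasurable"
    using assms by (intro sym_difference_lmeasurable closed_subsets_fmeasurable)
  then show ?thesis
    using assms by (simp add: ae_eq_def d_sym_def emeasure_eq_measure2)
qed

lemma convex_union_classes_rep:
  assumes "X \<in> convex_union_classes Q l"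
  obtains A where "A \<in> X" "A \<in> convex_unions Q l"
  using assms equiv_class_self[OF equiv_convex_unions]
  unfolding convex_union_classes_def by (metis quotientE)

theorem theorem5p1:
  fixes Q :: "(real ^ 'd) set" and l :: nat
  assumes "compact Q" and "connected Q" and "interior Q \<noteq> {}"
  shows "Metric_space (convex_union_classes Q l) d_class \<and>
         compact_space (Metric_space.mtopology (convex_union_classes Q l) d_class)"
proof -
  let ?M = "convex_union_classes Q l" and ?R = "Restr (ae_eq Q) (convex_unions Q l)"
  note Q = assms(1)
  note closed = subsetD[OF convex_unions_subset]
  note meas = closed_subsets_fmeasurable[OF Q closed]
  interpret Metric_space ?M d_class
  proof
    fix X Y :: "(real ^ 'd) set set"
    show "0 \<le> d_class X Y" by (simp add: d_class_def d_sym_def)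
    show "d_class X Y = d_class Y X" by (simp add: d_class_def d_sym_commute)
  next
    fix X Y assume XY: "X \<in> ?M" "Y \<in> ?M"
    obtain A where A: "A \<in> X" "A \<in> convex_unions Q l" using convex_union_classes_rep[OF XY(1)] .
    obtain B where B: "B \<in> Y" "B \<in> convex_unions Q l" using convex_union_classes_rep[OF XY(2)] .
    have "X = Y \<longleftrightarrow> (A, B) \<in> ?R"
      using quotient_eq_iff[OF equiv_convex_unions] XY A(1) B(1)
      unfolding convex_union_classes_def by blast
    then show "d_class X Y = 0 \<longleftrightarrow> X = Y"
      using A B ae_eq_iff_d_sym[OF Q closed closed] d_class_eq[OF Q XY A(1) B(1)] by auto
  next
    fix X Y Z assume XYZ: "X \<in> ?M" "Y \<in> ?M" "Z \<in> ?M"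
    obtain A where A: "A \<in> X" "A \<in> convex_unions Q l" using convex_union_classes_rep[OF XYZ(1)] .
    obtain B where B: "B \<in> Y" "B \<in> convex_unions Q l" using convex_union_classes_rep[OF XYZ(2)] .
    obtain C where C: "C \<in> Z" "C \<in> convex_unions Q l" using convex_union_classes_rep[OF XYZ(3)] .
    show "d_class X Z \<le> d_class X Y + d_class Y Z"
      using d_sym_triangle[OF meas meas meas, OF A(2) B(2) C(2)]
        d_class_eq[OF Q XYZ(1,2) A(1) B(1)] d_class_eq[OF Q XYZ(2,3) B(1) C(1)]
        d_class_eq[OF Q XYZ(1,3) A(1) C(1)]
      by simp
  qed
  \<comment> \<open>In a metric space, compactness follows from sequential compactness, so a
    convergent subsequence of classes is extracted through representatives.\<close>
  have "\<exists>L r. L \<in> ?M \<and> strict_mono r \<and> limitin mtopology (\<sigma> \<circ> r) L sequentially"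
    if "range \<sigma> \<subseteq> ?M" for \<sigma> :: "nat \<Rightarrow> _"
  proof -
    have \<sigma>: "\<sigma> n \<in> ?M" for n using that by blast
    then have "\<exists>A. A \<in> \<sigma> n \<and> A \<in> convex_unions Q l" for n
      using convex_union_classes_rep by metis
    then obtain A where A: "\<And>n. A n \<in> \<sigma> n" "\<And>n. A n \<in> convex_unions Q l" by metis
    obtain L r where L: "L \<in> convex_unions Q l" and r: "strict_mono (r :: nat \<Rightarrow> nat)"
      and lim: "(\<lambda>n. d_sym (A (r n)) L) \<longlonglongrightarrow> 0"
      using convex_unions_selection[OF Q, of A l] A(2) by metis
    have LM: "?R `` {L} \<in> ?M" unfolding convex_union_classes_def using L by (rule quotientI)
    have "L \<in> ?R `` {L}" using equiv_class_self[OF equiv_convex_unions L] .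
    \<comment> \<open>Independence of representatives replaces the sets picked by
      \<open>SOME\<close> with \<open>A (r n)\<close> and \<open>L\<close>, for which convergence is
      known.\<close>
    then have "d_class (\<sigma> (r n)) (?R `` {L}) = d_sym (A (r n)) L" for n
      using d_class_eq[OF Q \<sigma> LM A(1)] by blast
    then have "limitin mtopology (\<sigma> \<circ> r) (?R `` {L}) sequentially"
      using lim \<sigma> LM by (simp add: limitin_metric_dist_null)
    then show ?thesis using LM r by blast
  qed
  then show ?thesis
    using Metric_space_axioms by (auto simp: compact_space_sequentially)
qed

end
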